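(* Let $m \ge n$, let $A \in \mathbb{R}^{m\times m}$ be symmetric positive definite and let $Z \in \mathbb{R}^{m\times n}$ have full rank. Suppose the oblique $QR$ factorization algorithm based on the symmetric eigenvalue decomposition of $A$ (compute $A = VDV^T$ with $V$ orthogonal and $D$ diagonal; $X = V^TZ$; $W = D^{1/2}X$; Euclidean $QR$ factorization $W = YR$; $U = D^{-1/2}Y$; $Q = VU$) is executed in floating point arithmetic with unit roundoff $u$, with computed quantities $\tilde V, \tilde D, \tilde X, \tilde W, \tilde Y, \tilde R, \tilde U, \tilde Q$ (with the diagonal entries of $\tilde D$ positive, so that $\tilde D^{\pm 1/2}$ is defined). Then $$\| Z - \tilde Q\tilde R \|_2 \le c\,m^{5/2}u\, \|A^{-1/2}\|_2 \|\tilde R\|_2,$$ $$\| \tilde Q^T A \tilde Q - I \|_2 \le c\,m^{5/2}u\, \|A\|_2 \|\tilde Q\|_2^2 + O(u^2).$$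
   Context: Conventions. Standard floating point arithmetic is assumed: $\mathrm{fl}(x \,\mathrm{op}\, y) = (x \,\mathrm{op}\, y)(1+\delta)$, $|\delta| \le u$, for $\mathrm{op} \in \{+,-,*,/\}$, where $u$ is the machine precision. The letter $c$ denotes a small constant that may differ from one occurrence to another. The dimensions $m,n$ are assumed small enough relative to $1/u$ that the error bounds simplify (e.g. $nu < 1/2$, so that $nu/(1-nu) \le c\,nu$). $O(u^2)$ denotes terms of second order in $u$. $\|\cdot\|_2$ is the spectral norm; $A^{1/2}$ is the symmetric positive definite square root of $A$ and $A^{-1/2}$ its inverse. Error model for the kernels of the algorithm (standard backward error results): eigenvalue decomposition: $A + \Delta A = \tilde V\tilde D\tilde V^T$ with $\|\Delta A\|_2 \le c\,m^{5/2}u\,\|A\|_2$, and $\tilde V = V + \Delta E$ with $V$ exactly orthogonal and $\|\Delta E\|_2 \le c\,m^{5/2}u$; $\tilde X = \tilde V^TZ + \Delta X$ with $\|\Delta X\|_2 \le c\,mu\,\|Z\|_2$; $\tilde W = \tilde D^{1/2}(\tilde X + \Delta S)$ with $\|\Delta S\|_2 \le c\,u\,\|\tilde X\|_2$; Euclidean (Householder) $QR$: $\tilde W = \tilde Y\tilde R + \Delta W$ with $\|\Delta W\|_2 \le c\,mn^{3/2}u\,\|\tilde W\|_2$, where $\tilde Y$ is within $c\,mn^2u$ in 2-norm of an exactly orthonormal matrix; $\tilde U = \tilde D^{-1/2}(\tilde Y + \Delta U)$ with $\|\Delta U\|_2 \le c\,u\,\|\tilde Y\|_2$; $\tilde Q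 = \tilde V\tilde U + \Delta Q$ with $\|\Delta Q\|_2 \le c\,mu\,\|\tilde U\|_2$.
   Formalization: The first bound is proved when m^{5/2}u‖A‖‖A^{-1/2}‖² is at most a small constant, the second when the computed Y is within c m^{5/2}u (not only c mn²u) of an orthonormal matrix; without these conditions the stated error model admits counterexamples. *)

theory Defs
  imports Complex_Main "Jordan_Normal_Form.Matrix" "Jordan_Normal_Form.DL_Rank"
begin

text \<open>
  Matrices are the dimension-as-value matrices of Jordan_Normal_Form, because the constants
  in the error bounds must not depend on the dimensions.
\<close>

definition vec2_norm :: "real vec \<Rightarrow> real" where
  "vec2_norm v = sqrt (v \<bullet> v)"

definition spectral_norm :: "real mat \<Rightarrow> real" where
  "spectral_norm M = Sup {vec2_norm (M *\<^sub>v x) | x. x \<in> carrier_vec (dim_col M) \<and> vec2_norm x \<le> 1}"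

definition sym_pos_def :: "nat \<Rightarrow> real mat \<Rightarrow> bool" where
  "sym_pos_def m A \<longleftrightarrow> A \<in> carrier_mat m m \<and> transpose_mat A = A \<and>
     (\<forall>x \<in> carrier_vec m. x \<noteq> 0\<^sub>v m \<longrightarrow> x \<bullet> (A *\<^sub>v x) > 0)"

text \<open>
  The square root is used relationally: a symmetric positive definite \<^term>\<open>A\<close> has exactly one
  symmetric positive definite square root \<^term>\<open>S\<close>, and its inverse \<^term>\<open>T\<close> is unique.
\<close>

definition is_inv_sqrt :: "nat \<Rightarrow> real mat \<Rightarrow> real mat \<Rightarrow> bool" where
  "is_inv_sqrt m A T \<longleftrightarrow> T \<in> carrier_mat m m \<and>
     (\<exists>S. sym_pos_def m S \<and> S * S = A \<and> S * T = 1\<^sub>m m \<and> T * S = 1\<^sub>m m)"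

definition orthonormal_cols :: "nat \<Rightarrow> nat \<Rightarrow> real mat \<Rightarrow> bool" where
  "orthonormal_cols m n Y \<longleftrightarrow> Y \<in> carrier_mat m n \<and> transpose_mat Y * Y = 1\<^sub>m n"

definition near_orthonormal :: "nat \<Rightarrow> nat \<Rightarrow> real \<Rightarrow> real mat \<Rightarrow> bool" where
  "near_orthonormal m n \<delta> Y \<longleftrightarrow>
     (\<exists>Y0 E. orthonormal_cols m n Y0 \<and> E \<in> carrier_mat m n \<and> Y = Y0 + E \<and> spectral_norm E \<le> \<delta>)"

definition diag_sqrt :: "real mat \<Rightarrow> real mat" where
  "diag_sqrt D = mat_diag (dim_row D) (\<lambda>i. sqrt (D $$ (i, i)))"

definition diag_inv_sqrt :: "real mat \<Rightarrow> real mat" where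
  "diag_inv_sqrt D = mat_diag (dim_row D) (\<lambda>i. 1 / sqrt (D $$ (i, i)))"

text \<open>
  The backward error models of the six kernels. \<^term>\<open>K\<close> is a common upper bound for the small
  constants of the models, \<^term>\<open>u\<close> is the unit roundoff. The matrices \<^term>\<open>V\<close>, \<^term>\<open>D\<close>,
  \<^term>\<open>X\<close>, \<^term>\<open>W\<close>, \<^term>\<open>Y\<close>, \<^term>\<open>R\<close>, \<^term>\<open>U\<close>, \<^term>\<open>Q\<close> are the computed ones (those with a
  tilde), each kernel being fed with the computed output of the preceding ones.
\<close>

definition evd_model :: "real \<Rightarrow> real \<Rightarrow> nat \<Rightarrow> real mat \<Rightarrow> real mat \<Rightarrow> real mat \<Rightarrow> bool" where
  "evd_model K u m A V D \<longleftrightarrow>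
     D \<in> carrier_mat m m \<and> diagonal_mat D \<and> (\<forall>i<m. D $$ (i, i) > 0) \<and>
     (\<exists>dA \<in> carrier_mat m m. A + dA = V * D * transpose_mat V \<and>
        spectral_norm dA \<le> K * real m powr (5/2) * u * spectral_norm A) \<and>
     near_orthonormal m m (K * real m powr (5/2) * u) V"

definition vtz_model :: "real \<Rightarrow> real \<Rightarrow> nat \<Rightarrow> nat \<Rightarrow> real mat \<Rightarrow> real mat \<Rightarrow> real mat \<Rightarrow> bool" where
  "vtz_model K u m n V Z X \<longleftrightarrow>
     (\<exists>dX \<in> carrier_mat m n. X = transpose_mat V * Z + dX \<and>
        spectral_norm dX \<le> K * real m * u * spectral_norm Z)"

definition scale_model :: "real \<Rightarrow> real \<Rightarrow> nat \<Rightarrow> nat \<Rightarrow> real mat \<Rightarrow> real mat \<Rightarrow> real mat \<Rightarrow> bool" where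
  "scale_model K u m n D X W \<longleftrightarrow>
     (\<exists>dS \<in> carrier_mat m n. W = diag_sqrt D * (X + dS) \<and>
        spectral_norm dS \<le> K * u * spectral_norm X)"

definition qr_model :: "real \<Rightarrow> real \<Rightarrow> nat \<Rightarrow> nat \<Rightarrow> real mat \<Rightarrow> real mat \<Rightarrow> real mat \<Rightarrow> bool" where
  "qr_model K u m n W Y R \<longleftrightarrow>
     R \<in> carrier_mat n n \<and> upper_triangular R \<and>
     near_orthonormal m n (K * real m * (real n)\<^sup>2 * u) Y \<and>
     (\<exists>dW \<in> carrier_mat m n. W = Y * R + dW \<and>
        spectral_norm dW \<le> K * real m * real n powr (3/2) * u * spectral_norm W)"

definition unscale_model :: "real \<Rightarrow> real \<Rightarrow> nat \<Rightarrow> nat \<Rightarrow> real mat \<Rightarrow> real mat \<Rightarrow> real mat \<Rightarrow> bool" where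
  "unscale_model K u m n D Y U \<longleftrightarrow>
     (\<exists>dU \<in> carrier_mat m n. U = diag_inv_sqrt D * (Y + dU) \<and>
        spectral_norm dU \<le> K * u * spectral_norm Y)"

definition vu_model :: "real \<Rightarrow> real \<Rightarrow> nat \<Rightarrow> nat \<Rightarrow> real mat \<Rightarrow> real mat \<Rightarrow> real mat \<Rightarrow> bool" where
  "vu_model K u m n V U Q \<longleftrightarrow>
     (\<exists>dQ \<in> carrier_mat m n. Q = V * U + dQ \<and>
        spectral_norm dQ \<le> K * real m * u * spectral_norm U)"

definition evd_oblique_qr_computed ::
    "real \<Rightarrow> real \<Rightarrow> nat \<Rightarrow> nat \<Rightarrow> real mat \<Rightarrow> real mat \<Rightarrow> real mat \<Rightarrow> real mat \<Rightarrow> real mat \<Rightarrow>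
     real mat \<Rightarrow> real mat \<Rightarrow> real mat \<Rightarrow> real mat \<Rightarrow> real mat \<Rightarrow> bool" where
  "evd_oblique_qr_computed K u m n A Z V D X W Y R U Q \<longleftrightarrow>
     evd_model K u m A V D \<and>
     vtz_model K u m n V Z X \<and>
     scale_model K u m n D X W \<and>
     qr_model K u m n W Y R \<and>
     unscale_model K u m n D Y U \<and>
     vu_model K u m n V U Q"

end

theory Submission
  imports Defs "HOL-Analysis.L2_Norm"
begin

text \<open>
  With \<open>\<eta> = K m powr (5/2) u\<close>, the perturbed identity \<open>A + dA = V D V\<^sup>T\<close> and the near
  orthogonality of \<open>V\<close> give \<open>\<parallel>D^(1/2)\<parallel> \<le> 2 \<parallel>A\<parallel>^(1/2)\<close> and, if the condition number times \<open>\<eta>\<close> is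
  small, \<open>\<parallel>D^(-1/2)\<parallel> \<le> 3 \<parallel>A^(-1/2)\<parallel>\<close>.

  For the residual, \<open>Q R - Z\<close> is a sum of products each containing one of the error matrices or
  \<open>V V\<^sup>T - 1\<close>; all other factors, including \<open>Z\<close>, are controlled by \<open>\<parallel>D^(-1/2)\<parallel> \<parallel>R\<parallel>\<close>.

  For the loss of orthogonality, \<open>Q\<^sup>T (A + dA) Q = G\<^sup>T G\<close> with \<open>G = D^(1/2) V\<^sup>T Q = Y\<^sub>0 + H\<close>, where \<open>Y\<^sub>0\<close> is
  orthonormal and \<open>\<parallel>H\<parallel>\<close> is of order \<open>\<eta> s\<close> for \<open>s = \<parallel>A\<parallel>^(1/2) \<parallel>Q\<parallel>\<close>. Since \<open>s\<close> is bounded below by a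
  positive constant, \<open>2 \<parallel>H\<parallel> + \<parallel>H\<parallel>\<^sup>2\<close> is at most a constant times \<open>\<eta> s\<^sup>2\<close>, and no second-order
  term remains.
\<close>

section \<open>The Euclidean norm\<close>

text \<open>Passing to \<open>L2_set\<close> gives access to its triangle and Cauchy-Schwarz
  inequalities.\<close>

lemma vec2_norm_L2_set: "vec2_norm v = L2_set (\<lambda>i. v $ i) {0..<dim_vec v}"
  by (simp add: vec2_norm_def L2_set_def scalar_prod_def power2_eq_square)

lemma vec2_norm_nonneg [simp]: "0 \<le> vec2_norm v"
  by (simp add: vec2_norm_L2_set)

lemma vec2_norm_zero [simp]: "vec2_norm (0\<^sub>v n) = 0"
  by (simp add: vec2_norm_def)

lemma vec2_norm_eq_0: "vec2_norm v = 0 \<Longrightarrow> v = 0\<^sub>v (dim_vec v)"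
  by (intro eq_vecI) (auto simp: vec2_norm_L2_set L2_set_eq_0_iff)

lemma vec2_norm_power2: "(vec2_norm v)\<^sup>2 = v \<bullet> v"
  by (simp add: vec2_norm_def scalar_prod_def sum_nonneg)

lemma vec2_norm_smult: "vec2_norm (a \<cdot>\<^sub>v v) = \<bar>a\<bar> * vec2_norm v"
  by (simp add: vec2_norm_def real_sqrt_mult flip: mult.assoc)

lemma vec2_norm_triangle:
  assumes "dim_vec v = dim_vec w"
  shows "vec2_norm (v + w) \<le> vec2_norm v + vec2_norm w"
proof -
  have "vec2_norm (v + w) = L2_set (\<lambda>i. v $ i + w $ i) {0..<dim_vec w}"
    by (auto simp: vec2_norm_L2_set intro!: L2_set_cong)
  also have "\<dots> \<le> vec2_norm v + vec2_norm w"
    using assms by (simp add: vec2_norm_L2_set L2_set_triangle_ineq)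
  finally show ?thesis .
qed

lemma scalar_prod_le_vec2_norm:
  assumes "dim_vec v = dim_vec w"
  shows "v \<bullet> w \<le> vec2_norm v * vec2_norm w" "- (v \<bullet> w) \<le> vec2_norm v * vec2_norm w"
proof -
  have "\<bar>v \<bullet> w\<bar> \<le> (\<Sum>i\<in>{0..<dim_vec w}. \<bar>v $ i\<bar> * \<bar>w $ i\<bar>)"
    unfolding scalar_prod_def by (rule order_trans[OF sum_abs]) (simp add: abs_mult)
  also have "\<dots> \<le> vec2_norm v * vec2_norm w"
    using assms by (simp add: vec2_norm_L2_set L2_set_mult_ineq)
  finally show "v \<bullet> w \<le> vec2_norm v * vec2_norm w" "- (v \<bullet> w) \<le> vec2_norm v * vec2_norm w"
    by auto
qed

section \<open>The spectral norm\<close>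

text \<open>A real \<open>Sup\<close> is informative only for a set that is bounded above.
  Cauchy-Schwarz on each row supplies such a bound; its size never matters.\<close>

lemma vec2_norm_mult_mat_vec_bounded:
  "\<exists>B. \<forall>x \<in> carrier_vec (dim_col M). vec2_norm (M *\<^sub>v x) \<le> B * vec2_norm x"
proof (intro exI ballI)
  fix x :: "real vec" assume x: "x \<in> carrier_vec (dim_col M)"
  have "vec2_norm (M *\<^sub>v x) \<le> (\<Sum>i\<in>{0..<dim_row M}. \<bar>row M i \<bullet> x\<bar>)"
    using L2_set_le_sum_abs[of "\<lambda>i. (M *\<^sub>v x) $ i" "{0..<dim_row M}"]
    by (simp add: vec2_norm_L2_set)
  also have "\<dots> \<le> (\<Sum>i\<in>{0..<dim_row M}. vec2_norm (row M i) * vec2_norm x)"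
    using x scalar_prod_le_vec2_norm[of "row M _" x] by (intro sum_mono) (simp add: abs_le_iff)
  finally show "vec2_norm (M *\<^sub>v x) \<le> (\<Sum>i\<in>{0..<dim_row M}. vec2_norm (row M i)) * vec2_norm x"
    by (simp add: sum_distrib_right)
qed

lemma spectral_norm_unit_bound:
  assumes "x \<in> carrier_vec (dim_col M)" "vec2_norm x \<le> 1"
  shows "vec2_norm (M *\<^sub>v x) \<le> spectral_norm M"
proof -
  obtain B where B: "\<forall>x \<in> carrier_vec (dim_col M). vec2_norm (M *\<^sub>v x) \<le> B * vec2_norm x"
    using vec2_norm_mult_mat_vec_bounded by blast
  have "vec2_norm (M *\<^sub>v x) \<le> \<bar>B\<bar>" if "x \<in> carrier_vec (dim_col M)" "vec2_norm x \<le> 1" for x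
  proof -
    have "vec2_norm (M *\<^sub>v x) \<le> B * vec2_norm x" using B that by blast
    \<comment> \<open>The sign of \<open>B\<close> is unknown, so its absolute value serves as the
      bound.\<close>
    also have "\<dots> \<le> \<bar>B\<bar> * 1" using that by (intro mult_mono) auto
    finally show ?thesis by simp
  qed
  then have "bdd_above {vec2_norm (M *\<^sub>v x) | x. x \<in> carrier_vec (dim_col M) \<and> vec2_norm x \<le> 1}"
    by (intro bdd_aboveI[of _ "\<bar>B\<bar>"]) auto
  then show ?thesis
    unfolding spectral_norm_def using assms by (intro cSup_upper) auto
qed

lemma spectral_norm_nonneg [simp]: "0 \<le> spectral_norm M"
  using spectral_norm_unit_bound[of "0\<^sub>v (dim_col M)" M] order_trans[OF vec2_norm_nonneg] by simp

lemma spectral_norm_bound: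
  assumes x: "dim_vec x = dim_col M"
  shows "vec2_norm (M *\<^sub>v x) \<le> spectral_norm M * vec2_norm x"
proof (cases "vec2_norm x = 0")
  case True
  then have "x = 0\<^sub>v (dim_col M)" using vec2_norm_eq_0 x by metis
  then have "M *\<^sub>v x = 0\<^sub>v (dim_row M)" by (intro eq_vecI) auto
  then show ?thesis by simp
next
  case False
  then have pos: "vec2_norm x > 0" using vec2_norm_nonneg[of x] by linarith
  let ?y = "(1 / vec2_norm x) \<cdot>\<^sub>v x"
  have "M *\<^sub>v ?y = (1 / vec2_norm x) \<cdot>\<^sub>v (M *\<^sub>v x)"
    using x by (intro mult_mat_vec[of _ "dim_row M" "dim_col M"]) (auto intro: carrier_vecI)
  moreover have "vec2_norm (M *\<^sub>v ?y) \<le> spectral_norm M"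
    using x pos by (intro spectral_norm_unit_bound) (auto simp: vec2_norm_smult intro: carrier_vecI)
  ultimately show ?thesis using pos by (simp add: vec2_norm_smult field_simps)
qed

text \<open>Requiring \<open>0 \<le> B\<close> matters when \<open>M\<close> has no columns: the
  pointwise bound is then trivial for every \<open>B\<close>, while the norm is 0.\<close>

lemma spectral_norm_leI:
  assumes "0 \<le> B"
    and le: "\<And>x. x \<in> carrier_vec (dim_col M) \<Longrightarrow> vec2_norm (M *\<^sub>v x) \<le> B * vec2_norm x"
  shows "spectral_norm M \<le> B"
  unfolding spectral_norm_def
proof (rule cSup_least)
  show "{vec2_norm (M *\<^sub>v x) |x. x \<in> carrier_vec (dim_col M) \<and> vec2_norm x \<le> 1} \<noteq> {}"
    by (auto intro!: exI[of _ "0\<^sub>v (dim_col M)"])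
next
  fix b assume "b \<in> {vec2_norm (M *\<^sub>v x) |x. x \<in> carrier_vec (dim_col M) \<and> vec2_norm x \<le> 1}"
  then obtain x where x: "x \<in> carrier_vec (dim_col M)" "vec2_norm x \<le> 1" "b = vec2_norm (M *\<^sub>v x)"
    by auto
  have "B * vec2_norm x \<le> B * 1" using x \<open>0 \<le> B\<close> by (intro mult_left_mono) auto
  with le[OF x(1)] x show "b \<le> B" by simp
qed

lemma spectral_norm_mult:
  assumes "dim_col M = dim_row N"
  shows "spectral_norm (M * N) \<le> spectral_norm M * spectral_norm N"
proof (rule spectral_norm_leI)
  fix x :: "real vec" assume x: "x \<in> carrier_vec (dim_col (M * N))"
  then have "(M * N) *\<^sub>v x = M *\<^sub>v (N *\<^sub>v x)"
    using assms by (intro assoc_mult_mat_vec[of _ "dim_row M" "dim_col M" _ "dim_col N"]) auto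
  also have "vec2_norm \<dots> \<le> spectral_norm M * vec2_norm (N *\<^sub>v x)"
    using assms by (intro spectral_norm_bound) simp
  also have "\<dots> \<le> spectral_norm M * (spectral_norm N * vec2_norm x)"
    using x by (intro mult_left_mono spectral_norm_bound) auto
  finally show "vec2_norm ((M * N) *\<^sub>v x) \<le> spectral_norm M * spectral_norm N * vec2_norm x"
    by (simp add: mult.assoc)
qed simp

lemma spectral_norm_triangle:
  assumes "dim_row M = dim_row N" "dim_col M = dim_col N"
  shows "spectral_norm (M + N) \<le> spectral_norm M + spectral_norm N"
proof (rule spectral_norm_leI)
  fix x :: "real vec" assume x: "x \<in> carrier_vec (dim_col (M + N))"
  then have "(M + N) *\<^sub>v x = M *\<^sub>v x + N *\<^sub>v x"
    using assms by (intro add_mult_distrib_mat_vec[of _ "dim_row M" "dim_col M"]) auto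
  also have "vec2_norm \<dots> \<le> vec2_norm (M *\<^sub>v x) + vec2_norm (N *\<^sub>v x)"
    using assms by (intro vec2_norm_triangle) simp
  also have "\<dots> \<le> spectral_norm M * vec2_norm x + spectral_norm N * vec2_norm x"
    using x assms by (intro add_mono spectral_norm_bound) auto
  finally show "vec2_norm ((M + N) *\<^sub>v x) \<le> (spectral_norm M + spectral_norm N) * vec2_norm x"
    by (simp add: distrib_right)
qed simp

lemma spectral_norm_uminus [simp]: "spectral_norm (- M) = spectral_norm M"
proof -
  have "spectral_norm (- N) \<le> spectral_norm N" for N
  proof (rule spectral_norm_leI)
    fix x :: "real vec" assume x: "x \<in> carrier_vec (dim_col (- N))"
    then have "(- N) *\<^sub>v x = (-1) \<cdot>\<^sub>v (N *\<^sub>v x)" by (auto simp: uminus_mult_mat_vec)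
    then show "vec2_norm ((- N) *\<^sub>v x) \<le> spectral_norm N * vec2_norm x"
      using x by (simp add: vec2_norm_smult spectral_norm_bound)
  qed simp
  from this[of M] this[of "- M"] show ?thesis by simp
qed

lemma spectral_norm_triangle_minus:
  assumes "dim_row M = dim_row N" "dim_col M = dim_col N"
  shows "spectral_norm (M - N) \<le> spectral_norm M + spectral_norm N"
proof -
  have "M - N = M + - N" using assms by (intro eq_matI) auto
  then show ?thesis using spectral_norm_triangle[of M "- N"] assms by simp
qed

section \<open>Transposes and Gram matrices\<close>

lemma scalar_prod_mult_transpose:
  fixes M :: "real mat"
  assumes "dim_vec x = dim_row M" "dim_vec y = dim_col M"
  shows "(transpose_mat M *\<^sub>v x) \<bullet> y = x \<bullet> (M *\<^sub>v y)"
  using assms by (intro transpose_vec_mult_scalar[of _ "dim_row M" "dim_col M"])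
    (auto intro: carrier_vecI)

text \<open>Moving one transpose across the inner product writes the square of |M^T x| as x . (M M^T
  x), and one factor |M^T x| cancels. Equality follows by using this for \<open>M\<close> and for
  its transpose.\<close>

lemma spectral_norm_transpose [simp]: "spectral_norm (transpose_mat M) = spectral_norm M"
proof -
  have "spectral_norm (transpose_mat N) \<le> spectral_norm N" for N
  proof (rule spectral_norm_leI)
    fix x :: "real vec" assume x: "x \<in> carrier_vec (dim_col (transpose_mat N))"
    let ?y = "transpose_mat N *\<^sub>v x"
    have "(vec2_norm ?y)\<^sup>2 = x \<bullet> (N *\<^sub>v ?y)"
      unfolding vec2_norm_power2 using x by (intro scalar_prod_mult_transpose) auto
    also have "\<dots> \<le> vec2_norm x * vec2_norm (N *\<^sub>v ?y)"
      using x by (intro scalar_prod_le_vec2_norm(1)) auto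
    also have "\<dots> \<le> vec2_norm x * (spectral_norm N * vec2_norm ?y)"
      by (intro mult_left_mono spectral_norm_bound) auto
    finally have "vec2_norm ?y * vec2_norm ?y \<le> (spectral_norm N * vec2_norm x) * vec2_norm ?y"
      by (simp add: power2_eq_square mult_ac)
    then show "vec2_norm ?y \<le> spectral_norm N * vec2_norm x"
      by (cases "vec2_norm ?y = 0") (auto simp: mult_le_cancel_right order_less_le)
  qed simp
  from this[of M] this[of "transpose_mat M"] show ?thesis by simp
qed

text \<open>Only an inequality, since the norm is 0 for \<open>n = 0\<close>.\<close>

lemma spectral_norm_one_le: "spectral_norm (1\<^sub>m n) \<le> 1"
  by (rule spectral_norm_leI) auto

text \<open>The square of |P x| is the quadratic form of the Gram matrix at x. This bounds a factor
  of A + dA by the norm of A + dA without any spectral theory.\<close>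

lemma spectral_norm_gram_ge: "(spectral_norm P)\<^sup>2 \<le> spectral_norm (transpose_mat P * P)"
proof -
  let ?G = "transpose_mat P * P"
  have "spectral_norm P \<le> sqrt (spectral_norm ?G)"
  proof (rule spectral_norm_leI)
    fix x :: "real vec" assume x: "x \<in> carrier_vec (dim_col P)"
    have "(vec2_norm (P *\<^sub>v x))\<^sup>2 = x \<bullet> (transpose_mat P *\<^sub>v (P *\<^sub>v x))"
      using x scalar_prod_mult_transpose[of x "transpose_mat P" "P *\<^sub>v x"]
      by (simp add: vec2_norm_power2)
    also have "transpose_mat P *\<^sub>v (P *\<^sub>v x) = ?G *\<^sub>v x"
      using x by (intro assoc_mult_mat_vec[symmetric, of _ "dim_col P" "dim_row P" _ "dim_col P"]) auto
    also have "x \<bullet> (?G *\<^sub>v x) \<le> vec2_norm x * (spectral_norm ?G * vec2_norm x)"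
      using x by (intro order_trans[OF scalar_prod_le_vec2_norm(1)]
          mult_left_mono spectral_norm_bound) auto
    finally have "(vec2_norm (P *\<^sub>v x))\<^sup>2 \<le> (sqrt (spectral_norm ?G) * vec2_norm x)\<^sup>2"
      by (simp add: power2_eq_square mult_ac)
    then show "vec2_norm (P *\<^sub>v x) \<le> sqrt (spectral_norm ?G) * vec2_norm x"
      by (rule power2_le_imp_le) simp
  qed simp
  then show ?thesis using power_mono[of "spectral_norm P" "sqrt (spectral_norm ?G)" 2] by simp
qed

section \<open>Nearly orthonormal matrices\<close>

text \<open>The library versions of these laws have carrier premises whose dimensions do not occur in
  the conclusion, so they cannot be used as rewrite rules; the ones below can.\<close>

lemma mat_assoc_dim:
  fixes A B C :: "real mat"
  assumes "dim_col A = dim_row B" "dim_col B = dim_row C"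
  shows "(A * B) * C = A * (B * C)"
  using assms by (intro assoc_mult_mat[of _ "dim_row A" "dim_col A" _ "dim_col B" _ "dim_col C"]) auto

lemma mat_distrib_dim:
  fixes A B C :: "real mat"
  shows "dim_row A = dim_row B \<Longrightarrow> dim_col A = dim_col B \<Longrightarrow> dim_col A = dim_row C
      \<Longrightarrow> (A + B) * C = A * C + B * C"
    and "dim_row B = dim_row C \<Longrightarrow> dim_col B = dim_col C \<Longrightarrow> dim_col A = dim_row B
      \<Longrightarrow> A * (B + C) = A * B + A * C"
    and "dim_row A = dim_row B \<Longrightarrow> dim_col A = dim_col B \<Longrightarrow> dim_col A = dim_row C
      \<Longrightarrow> (A - B) * C = A * C - B * C"
    and "dim_row B = dim_row C \<Longrightarrow> dim_col B = dim_col C \<Longrightarrow> dim_col A = dim_row B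
      \<Longrightarrow> A * (B - C) = A * B - A * C"
  by (intro add_mult_distrib_mat[of _ "dim_row A" "dim_col A"]
      mult_add_distrib_mat[of _ "dim_row A" "dim_col A" _ "dim_col B"]
      minus_mult_distrib_mat[of _ "dim_row A" "dim_col A"]
      mult_minus_distrib_mat[of _ "dim_row A" "dim_col A" _ "dim_col B"]; auto)+

lemma mat_transpose_dim:
  fixes A B :: "real mat"
  shows "dim_col A = dim_row B
      \<Longrightarrow> transpose_mat (A * B) = transpose_mat B * transpose_mat A"
    and "dim_row A = dim_row B \<Longrightarrow> dim_col A = dim_col B
      \<Longrightarrow> transpose_mat (A + B) = transpose_mat A + transpose_mat B"
    and "dim_row A = dim_row B \<Longrightarrow> dim_col A = dim_col B
      \<Longrightarrow> transpose_mat (A - B) = transpose_mat A - transpose_mat B"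
  by (intro transpose_mult[of _ "dim_row A" "dim_col A" _ "dim_col B"]
      transpose_add[of _ "dim_row A" "dim_col A"]
      transpose_minus[of _ "dim_row A" "dim_col A"]; auto)+

lemmas mat_ring_dim = mat_assoc_dim mat_distrib_dim mat_transpose_dim

section \<open>Isometries and their perturbations\<close>

lemma vec2_norm_orthonormal_cols:
  assumes "orthonormal_cols m n Y" "dim_vec x = n"
  shows "vec2_norm (Y *\<^sub>v x) = vec2_norm x"
proof -
  have Y: "dim_row Y = m" "dim_col Y = n" "transpose_mat Y * Y = 1\<^sub>m n"
    using assms by (auto simp: orthonormal_cols_def)
  have "(Y *\<^sub>v x) \<bullet> (Y *\<^sub>v x) = (transpose_mat Y *\<^sub>v (Y *\<^sub>v x)) \<bullet> x"
    using Y assms by (subst scalar_prod_mult_transpose) auto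
  also have "transpose_mat Y *\<^sub>v (Y *\<^sub>v x) = (transpose_mat Y * Y) *\<^sub>v x"
    using Y assms by (intro assoc_mult_mat_vec[symmetric, of _ n m _ n]) (auto intro: carrier_vecI)
  also have "\<dots> = x" unfolding Y(3) using assms by (intro one_mult_mat_vec carrier_vecI)
  finally show ?thesis by (simp add: vec2_norm_def)
qed

lemma spectral_norm_orthonormal_cols:
  assumes "orthonormal_cols m n Y"
  shows "spectral_norm Y \<le> 1"
proof (rule spectral_norm_leI)
  fix x :: "real vec" assume "x \<in> carrier_vec (dim_col Y)"
  then show "vec2_norm (Y *\<^sub>v x) \<le> 1 * vec2_norm x"
    using vec2_norm_orthonormal_cols[OF assms] assms by (auto simp: orthonormal_cols_def)
qed simp

text \<open>A unit vector, available because \<open>0 < n\<close>, keeps its length. This is the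
  source of the lower bound on the product of the square root of the norm of A with the norm of
  Q.\<close>

lemma spectral_norm_orthonormal_cols_ge:
  assumes "orthonormal_cols m n Y" "0 < n"
  shows "1 \<le> spectral_norm Y"
proof -
  have "vec2_norm (unit_vec n 0 :: real vec) = 1" using assms by (simp add: vec2_norm_def)
  then show ?thesis
    using spectral_norm_bound[of "unit_vec n 0" Y] vec2_norm_orthonormal_cols[OF assms(1), of "unit_vec n 0"] assms
    by (auto simp: orthonormal_cols_def)
qed

text \<open>For a square matrix a left inverse is also a right inverse.\<close>

lemma orthonormal_cols_transpose:
  assumes "orthonormal_cols m m V"
  shows "orthonormal_cols m m (transpose_mat V)"
  using assms mat_mult_left_right_inverse[of "transpose_mat V" m V]
  by (auto simp: orthonormal_cols_def)

lemma spectral_norm_orthonormal_mult: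
  assumes "orthonormal_cols m n Y" "dim_row M = n"
  shows "spectral_norm (Y * M) = spectral_norm M"
proof (rule antisym)
  have Y: "dim_row Y = m" "dim_col Y = n" "transpose_mat Y * Y = 1\<^sub>m n"
    using assms by (auto simp: orthonormal_cols_def)
  have *: "vec2_norm ((Y * M) *\<^sub>v x) = vec2_norm (M *\<^sub>v x)" if "x \<in> carrier_vec (dim_col M)" for x
  proof -
    have "(Y * M) *\<^sub>v x = Y *\<^sub>v (M *\<^sub>v x)"
      using Y assms that by (intro assoc_mult_mat_vec[of _ m n _ "dim_col M"]) auto
    then show ?thesis using vec2_norm_orthonormal_cols[OF assms(1)] assms by simp
  qed
  show "spectral_norm (Y * M) \<le> spectral_norm M"
    using * by (intro spectral_norm_leI) (auto simp: spectral_norm_bound)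
  show "spectral_norm M \<le> spectral_norm (Y * M)"
  proof (rule spectral_norm_leI)
    fix x :: "real vec" assume x: "x \<in> carrier_vec (dim_col M)"
    then show "vec2_norm (M *\<^sub>v x) \<le> spectral_norm (Y * M) * vec2_norm x"
      using *[OF x] spectral_norm_bound[of x "Y * M"] by simp
  qed simp
qed

text \<open>Expanding the product, the exact Gram matrix cancels the identity and leaves two terms
  linear in \<open>E\<close> and one quadratic term.\<close>

lemma spectral_norm_gram_perturbed:
  assumes Y: "orthonormal_cols m n Y" and E: "E \<in> carrier_mat m n"
  shows "spectral_norm (transpose_mat (Y + E) * (Y + E) - 1\<^sub>m n)
           \<le> 2 * spectral_norm E + (spectral_norm E)\<^sup>2"
proof -
  have d: "dim_row Y = m" "dim_col Y = n" "dim_row E = m" "dim_col E = n"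
      "transpose_mat Y * Y = 1\<^sub>m n"
    using assms by (auto simp: orthonormal_cols_def)
  have "transpose_mat (Y + E) * (Y + E) - 1\<^sub>m n
      = transpose_mat Y * E + transpose_mat E * Y + transpose_mat E * E"
    using d by (intro eq_matI) (simp_all add: mat_ring_dim del: index_mult_mat(1))
  also have "spectral_norm \<dots> \<le> spectral_norm (transpose_mat Y * E)
      + spectral_norm (transpose_mat E * Y) + spectral_norm (transpose_mat E * E)"
    using d by (intro order_trans[OF spectral_norm_triangle] add_right_mono spectral_norm_triangle) auto
  also have "\<dots> \<le> 1 * spectral_norm E + spectral_norm E * 1 + spectral_norm E * spectral_norm E"
    using d spectral_norm_orthonormal_cols[OF Y]
    by (intro add_mono order_trans[OF spectral_norm_mult] mult_mono) auto
  finally show ?thesis by (simp add: power2_eq_square)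
qed

lemma spectral_norm_near_orthonormal:
  assumes "near_orthonormal m n \<delta> Y"
  shows "spectral_norm Y \<le> 1 + \<delta>"
proof -
  obtain Y0 E where Y: "orthonormal_cols m n Y0" "E \<in> carrier_mat m n" "Y = Y0 + E" "spectral_norm E \<le> \<delta>"
    using assms by (auto simp: near_orthonormal_def)
  have "spectral_norm Y \<le> spectral_norm Y0 + spectral_norm E"
    unfolding Y using Y by (intro spectral_norm_triangle) (auto simp: orthonormal_cols_def)
  then show ?thesis using Y spectral_norm_orthonormal_cols[OF Y(1)] by simp
qed

lemma near_orthonormal_nonneg: "near_orthonormal m n \<delta> Y \<Longrightarrow> 0 \<le> \<delta>"
  using order_trans[OF spectral_norm_nonneg] by (auto simp: near_orthonormal_def)

lemma near_orthonormal_carrier: "near_orthonormal m n \<delta> Y \<Longrightarrow> Y \<in> carrier_mat m n"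
  by (auto simp: near_orthonormal_def)

text \<open>This transfers the estimates for \<open>V\<close> to V V^T - 1 and to V^T Z.\<close>

lemma near_orthonormal_transpose:
  assumes "near_orthonormal m m \<delta> V"
  shows "near_orthonormal m m \<delta> (transpose_mat V)"
proof -
  obtain V0 E where V: "orthonormal_cols m m V0" "E \<in> carrier_mat m m" "V = V0 + E" "spectral_norm E \<le> \<delta>"
    using assms by (auto simp: near_orthonormal_def)
  have "transpose_mat V = transpose_mat V0 + transpose_mat E"
    using V by (auto simp: orthonormal_cols_def mat_transpose_dim)
  with V show ?thesis unfolding near_orthonormal_def
    using V by (intro exI[of _ "transpose_mat V0"] exI[of _ "transpose_mat E"])
      (simp add: orthonormal_cols_transpose)
qed

lemma spectral_norm_near_orthonormal_gram:
  assumes "near_orthonormal m n \<delta> Y" "\<delta> \<le> 1"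
  shows "spectral_norm (transpose_mat Y * Y - 1\<^sub>m n) \<le> 3 * \<delta>"
proof -
  obtain Y0 E where Y: "orthonormal_cols m n Y0" "E \<in> carrier_mat m n" "Y = Y0 + E" "spectral_norm E \<le> \<delta>"
    using assms by (auto simp: near_orthonormal_def)
  have "spectral_norm (transpose_mat Y * Y - 1\<^sub>m n) \<le> 2 * spectral_norm E + (spectral_norm E)\<^sup>2"
    unfolding Y(3) using Y by (intro spectral_norm_gram_perturbed) auto
  \<comment> \<open>The assumption \<open>\<delta> \<le> 1\<close> makes the quadratic term
    linear.\<close>
  also have "\<dots> \<le> 2 * \<delta> + \<delta> * 1"
    unfolding power2_eq_square using Y assms near_orthonormal_nonneg[OF assms(1)] by (intro add_mono mult_mono) auto
  finally show ?thesis by simp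
qed

text \<open>Write V0 M = V M - E M, where the exact factor V0 preserves the norm of
  \<open>M\<close>. The estimate takes the place of an inverse of \<open>V\<close>.\<close>

lemma spectral_norm_le_near_orthonormal_mult:
  assumes "near_orthonormal m n \<delta> V" "dim_row M = n"
  shows "(1 - \<delta>) * spectral_norm M \<le> spectral_norm (V * M)"
proof -
  obtain V0 E where V: "orthonormal_cols m n V0" "E \<in> carrier_mat m n" "V = V0 + E" "spectral_norm E \<le> \<delta>"
    using assms by (auto simp: near_orthonormal_def)
  have d: "dim_row V0 = m" "dim_col V0 = n" "dim_row E = m" "dim_col E = n"
    using V by (auto simp: orthonormal_cols_def)
  have "V0 * M = V * M - E * M"
    unfolding V using d assms(2) by (intro eq_matI) (simp_all add: mat_ring_dim del: index_mult_mat(1))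
  then have "spectral_norm M = spectral_norm (V * M - E * M)"
    using spectral_norm_orthonormal_mult[OF V(1) assms(2)] by simp
  also have "\<dots> \<le> spectral_norm (V * M) + spectral_norm (E * M)"
    using d V assms by (intro spectral_norm_triangle_minus) auto
  also have "spectral_norm (E * M) \<le> \<delta> * spectral_norm M"
    using d V assms by (intro order_trans[OF spectral_norm_mult] mult_right_mono) auto
  finally show ?thesis by (simp add: algebra_simps)
qed


section \<open>Diagonal scaling by the computed eigenvalues\<close>

text \<open>Later lemmas speak of abstract matrices \<open>B\<close> and \<open>N\<close>; these
  identities are all they use of the diagonal structure.\<close>

lemma diag_sqrt_props:
  assumes "D \<in> carrier_mat m m" "diagonal_mat D" "\<forall>i<m. D $$ (i, i) > 0"
  shows "diag_sqrt D \<in> carrier_mat m m" "diag_inv_sqrt D \<in> carrier_mat m m"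
    and "transpose_mat (diag_sqrt D) = diag_sqrt D"
    and "diag_sqrt D * diag_sqrt D = D"
    and "diag_sqrt D * diag_inv_sqrt D = 1\<^sub>m m" "diag_inv_sqrt D * diag_sqrt D = 1\<^sub>m m"
proof -
  have pos: "0 < D $$ (i, i)" if "i < m" for i using assms that by auto
  then have nz: "D $$ (i, i) \<noteq> 0" if "i < m" for i using that by fastforce
  show "diag_sqrt D \<in> carrier_mat m m" "diag_inv_sqrt D \<in> carrier_mat m m"
    using assms by (auto simp: diag_sqrt_def diag_inv_sqrt_def mat_diag_def)
  show "transpose_mat (diag_sqrt D) = diag_sqrt D"
    by (intro eq_matI) (auto simp: diag_sqrt_def mat_diag_def)
  show "diag_sqrt D * diag_sqrt D = D"
    using assms pos unfolding diag_sqrt_def mat_diag_diag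
    by (intro eq_matI) (auto simp: mat_diag_def diagonal_mat_def less_imp_le)
  show "diag_sqrt D * diag_inv_sqrt D = 1\<^sub>m m"
    using assms unfolding diag_sqrt_def diag_inv_sqrt_def mat_diag_diag
    by (intro eq_matI) (auto simp: mat_diag_def nz)
  show "diag_inv_sqrt D * diag_sqrt D = 1\<^sub>m m"
    using assms unfolding diag_sqrt_def diag_inv_sqrt_def mat_diag_diag
    by (intro eq_matI) (auto simp: mat_diag_def nz)
qed

text \<open>Coercivity of A: x = T (S x), and the square of |S x| is x . (A x) because S is
  symmetric with S S = A.\<close>

lemma vec2_norm_inv_sqrt_le:
  assumes "is_inv_sqrt m A T" "dim_vec x = m"
  shows "(vec2_norm x)\<^sup>2 \<le> (spectral_norm T)\<^sup>2 * (x \<bullet> (A *\<^sub>v x))"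
proof -
  obtain S where S: "sym_pos_def m S" "S * S = A" "T * S = 1\<^sub>m m" and T: "T \<in> carrier_mat m m"
    using assms by (auto simp: is_inv_sqrt_def)
  have Sc: "S \<in> carrier_mat m m" "transpose_mat S = S" using S by (auto simp: sym_pos_def_def)
  have x: "x \<in> carrier_vec m" using assms by (auto intro: carrier_vecI)
  have "x = (T * S) *\<^sub>v x" using S x by simp
  also have "\<dots> = T *\<^sub>v (S *\<^sub>v x)" using T Sc x by (intro assoc_mult_mat_vec) auto
  finally have "vec2_norm x \<le> spectral_norm T * vec2_norm (S *\<^sub>v x)"
    using spectral_norm_bound[of "S *\<^sub>v x" T] T Sc by auto
  then have "(vec2_norm x)\<^sup>2 \<le> (spectral_norm T * vec2_norm (S *\<^sub>v x))\<^sup>2"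
    by (intro power_mono) auto
  then have le: "(vec2_norm x)\<^sup>2 \<le> (spectral_norm T)\<^sup>2 * (vec2_norm (S *\<^sub>v x))\<^sup>2"
    by (simp add: power_mult_distrib)
  have "(vec2_norm (S *\<^sub>v x))\<^sup>2 = x \<bullet> (S *\<^sub>v (S *\<^sub>v x))"
    using scalar_prod_mult_transpose[of x S "S *\<^sub>v x"] Sc assms by (simp add: vec2_norm_power2)
  then have "(vec2_norm (S *\<^sub>v x))\<^sup>2 = x \<bullet> (A *\<^sub>v x)"
    using assoc_mult_mat_vec[OF Sc(1) Sc(1) x] S by simp
  with le show ?thesis by simp
qed

text \<open>P = \<open>B * transpose_mat V\<close> has Gram matrix A + dA, which bounds P. Since the
  transpose of P is \<open>V * B\<close> and \<open>V\<close> is nearly an isometry,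
  \<open>B\<close> is hardly larger than P.\<close>

lemma spectral_norm_sqrt_factor_le:
  assumes A: "A \<in> carrier_mat m m" and dA: "dA \<in> carrier_mat m m" "spectral_norm dA \<le> \<eta> * spectral_norm A"
    and V: "near_orthonormal m m \<eta> V" and B: "B \<in> carrier_mat m m" "transpose_mat B = B"
    and eq: "A + dA = V * (B * B) * transpose_mat V" and \<eta>: "\<eta> \<le> 1/16"
  shows "spectral_norm B \<le> 2 * sqrt (spectral_norm A)"
proof -
  note \<eta>0 = near_orthonormal_nonneg[OF V]
  have Vc: "V \<in> carrier_mat m m" using V by (rule near_orthonormal_carrier)
  let ?P = "B * transpose_mat V"
  have tP: "transpose_mat ?P = V * B" using Vc B by (simp add: mat_ring_dim)
  have "(spectral_norm ?P)\<^sup>2 \<le> spectral_norm (transpose_mat ?P * ?P)" by (rule spectral_norm_gram_ge)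
  also have "transpose_mat ?P * ?P = A + dA" unfolding eq tP using Vc B by (simp add: mat_ring_dim)
  also have "spectral_norm (A + dA) \<le> spectral_norm A + \<eta> * spectral_norm A"
    using A dA by (intro order_trans[OF spectral_norm_triangle]) auto
  also have "\<dots> \<le> (17/16) * spectral_norm A"
    using mult_right_mono[OF \<eta> spectral_norm_nonneg[of A]] by (simp add: algebra_simps)
  finally have 1: "(spectral_norm ?P)\<^sup>2 \<le> (17/16) * spectral_norm A" .
  have "(15/16) * spectral_norm B \<le> (1 - \<eta>) * spectral_norm B"
    using \<eta> by (intro mult_right_mono) auto
  also have "\<dots> \<le> spectral_norm ?P"
    using spectral_norm_le_near_orthonormal_mult[OF V, of B] B spectral_norm_transpose[of ?P] tP by auto
  finally have "((15/16) * spectral_norm B)\<^sup>2 \<le> (spectral_norm ?P)\<^sup>2"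
    by (intro power_mono) auto
  then have "225 * (spectral_norm B)\<^sup>2 \<le> 256 * (spectral_norm ?P)\<^sup>2"
    by (simp add: power_mult_distrib power_divide)
  \<comment> \<open>The factor obtained is (256/225) (17/16), well below 4.\<close>
  with 1 have "(spectral_norm B)\<^sup>2 \<le> 4 * spectral_norm A"
    using spectral_norm_nonneg[of A] by linarith
  then have "(spectral_norm B)\<^sup>2 \<le> (2 * sqrt (spectral_norm A))\<^sup>2"
    by (simp add: power_mult_distrib)
  then show ?thesis by (rule power2_le_imp_le) simp
qed

text \<open>Inversion amplifies \<open>dA\<close> by the condition number of A, hence
  \<open>\<kappa>\<close>. Coercivity bounds P = \<open>B * transpose_mat V\<close> from below, and
  P maps V0 N to the identity plus a remainder containing \<open>N\<close> itself, which is absorbed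
  on the left.\<close>

lemma spectral_norm_inverse_sqrt_factor_le:
  assumes A: "A \<in> carrier_mat m m" and dA: "dA \<in> carrier_mat m m" "spectral_norm dA \<le> \<eta> * spectral_norm A"
    and V: "near_orthonormal m m \<eta> V" and B: "B \<in> carrier_mat m m" "transpose_mat B = B"
    and N: "N \<in> carrier_mat m m" "B * N = 1\<^sub>m m"
    and eq: "A + dA = V * (B * B) * transpose_mat V" and \<eta>: "\<eta> \<le> 1/16"
    and T: "is_inv_sqrt m A T" and \<kappa>: "\<eta> * (spectral_norm A * (spectral_norm T)\<^sup>2) \<le> 1/16"
  shows "spectral_norm N \<le> 3 * spectral_norm T"
proof -
  note \<eta>0 = near_orthonormal_nonneg[OF V]
  define t where "t = spectral_norm T"
  define a where "a = spectral_norm A"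
  have t: "0 \<le> t" "0 \<le> a" by (auto simp: t_def a_def)
  have Vc: "V \<in> carrier_mat m m" using V by (rule near_orthonormal_carrier)
  let ?P = "B * transpose_mat V"
  have P: "?P \<in> carrier_mat m m" using B Vc by auto
  have PP: "transpose_mat ?P * ?P = A + dA" unfolding eq using Vc B by (simp add: mat_ring_dim)
  \<comment> \<open>The form of A + dA differs from that of A by at most \<eta> a |x|^2. Multiplied
    by t^2 this is at most |x|^2 / 16 by \<open>\<kappa>\<close>, and is absorbed.\<close>
  have low: "vec2_norm x \<le> 2 * t * vec2_norm (?P *\<^sub>v x)" if "dim_vec x = m" for x
  proof -
    have x: "x \<in> carrier_vec m" using that by (auto intro: carrier_vecI)
    have "(vec2_norm (?P *\<^sub>v x))\<^sup>2 = x \<bullet> (transpose_mat ?P *\<^sub>v (?P *\<^sub>v x))"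
      using that P Vc B scalar_prod_mult_transpose[of x "transpose_mat ?P" "?P *\<^sub>v x"]
      by (simp add: vec2_norm_power2)
    also have "transpose_mat ?P *\<^sub>v (?P *\<^sub>v x) = (A + dA) *\<^sub>v x"
      unfolding PP[symmetric] using x P
      by (intro assoc_mult_mat_vec[symmetric, of _ m m _ m]) auto
    also have "\<dots> = A *\<^sub>v x + dA *\<^sub>v x" using A dA x by (intro add_mult_distrib_mat_vec) auto
    also have "x \<bullet> \<dots> = x \<bullet> (A *\<^sub>v x) + x \<bullet> (dA *\<^sub>v x)"
      using A dA x by (intro scalar_prod_add_distrib[of _ m]) auto
    finally have 1: "x \<bullet> (A *\<^sub>v x) = (vec2_norm (?P *\<^sub>v x))\<^sup>2 - x \<bullet> (dA *\<^sub>v x)" by simp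
    have "- (x \<bullet> (dA *\<^sub>v x)) \<le> vec2_norm x * vec2_norm (dA *\<^sub>v x)"
      using scalar_prod_le_vec2_norm(2)[of x "dA *\<^sub>v x"] dA that by auto
    also have "\<dots> \<le> vec2_norm x * (spectral_norm dA * vec2_norm x)"
      using that dA by (intro mult_left_mono spectral_norm_bound) auto
    also have "\<dots> \<le> vec2_norm x * ((\<eta> * a) * vec2_norm x)"
      using dA by (intro mult_left_mono mult_right_mono) (auto simp: a_def)
    finally have 2: "x \<bullet> (A *\<^sub>v x) \<le> (vec2_norm (?P *\<^sub>v x))\<^sup>2 + \<eta> * a * (vec2_norm x)\<^sup>2"
      unfolding 1 by (simp add: power2_eq_square mult_ac)
    have "(vec2_norm x)\<^sup>2 \<le> t\<^sup>2 * (x \<bullet> (A *\<^sub>v x))"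
      unfolding t_def by (rule vec2_norm_inv_sqrt_le[OF T that])
    also have "\<dots> \<le> t\<^sup>2 * ((vec2_norm (?P *\<^sub>v x))\<^sup>2 + \<eta> * a * (vec2_norm x)\<^sup>2)"
      using 2 by (intro mult_left_mono) auto
    also have "\<dots> = t\<^sup>2 * (vec2_norm (?P *\<^sub>v x))\<^sup>2 + (\<eta> * (a * t\<^sup>2)) * (vec2_norm x)\<^sup>2"
      by (simp add: algebra_simps)
    also have "\<dots> \<le> t\<^sup>2 * (vec2_norm (?P *\<^sub>v x))\<^sup>2 + (1/16) * (vec2_norm x)\<^sup>2"
      using \<kappa> by (intro add_left_mono mult_right_mono) (auto simp: a_def t_def)
    finally have "(vec2_norm x)\<^sup>2 \<le> (16/15) * (t\<^sup>2 * (vec2_norm (?P *\<^sub>v x))\<^sup>2)" by simp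
    \<comment> \<open>Rounding 16/15 up to 4 makes the right side the square of
      \<open>2 * t * vec2_norm (?P *\<^sub>v x)\<close>.\<close>
    also have "\<dots> \<le> 4 * (t\<^sup>2 * (vec2_norm (?P *\<^sub>v x))\<^sup>2)" by (intro mult_right_mono) auto
    finally have "(vec2_norm x)\<^sup>2 \<le> (2 * t * vec2_norm (?P *\<^sub>v x))\<^sup>2"
      by (simp add: power_mult_distrib)
    then show ?thesis by (rule power2_le_imp_le) (simp add: t)
  qed
  \<comment> \<open>Apply the lower bound to the range of the exactly orthogonal factor, so that the computed
    factor need not be inverted.\<close>
  obtain V0 E where V0: "orthonormal_cols m m V0" "E \<in> carrier_mat m m" "V = V0 + E" "spectral_norm E \<le> \<eta>"
    using V by (auto simp: near_orthonormal_def)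
  have d: "dim_row V0 = m" "dim_col V0 = m" "dim_row E = m" "dim_col E = m"
      "dim_row B = m" "dim_col B = m" "dim_row N = m" "dim_col N = m"
      "transpose_mat V0 * V0 = 1\<^sub>m m"
    using V0 B N by (auto simp: orthonormal_cols_def)
  have "spectral_norm N = spectral_norm (V0 * N)"
    using spectral_norm_orthonormal_mult[OF V0(1)] d by simp
  also have "\<dots> \<le> 2 * t * spectral_norm (?P * (V0 * N))"
  proof (rule spectral_norm_leI)
    fix x :: "real vec" assume x: "x \<in> carrier_vec (dim_col (V0 * N))"
    have "vec2_norm ((V0 * N) *\<^sub>v x) \<le> 2 * t * vec2_norm (?P *\<^sub>v ((V0 * N) *\<^sub>v x))"
      using d by (intro low) auto
    also have "?P *\<^sub>v ((V0 * N) *\<^sub>v x) = (?P * (V0 * N)) *\<^sub>v x"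
      using P d x by (intro assoc_mult_mat_vec[symmetric, of _ m m _ m]) auto
    also have "2 * t * vec2_norm \<dots> \<le> 2 * t * (spectral_norm (?P * (V0 * N)) * vec2_norm x)"
      using x t by (intro mult_left_mono spectral_norm_bound) auto
    finally show "vec2_norm ((V0 * N) *\<^sub>v x) \<le> 2 * t * spectral_norm (?P * (V0 * N)) * vec2_norm x"
      by (simp add: mult.assoc)
  qed (simp add: t)
  \<comment> \<open>The first summand is \<open>B * N\<close>, the identity; the second carries
    \<open>E\<close> and thus a factor \<eta>.\<close>
  also have "?P * (V0 * N) = B * ((transpose_mat V0 * V0) * N) + B * (transpose_mat E * (V0 * N))"
    unfolding V0(3) using d(1-8) by (simp add: mat_ring_dim)
  also have "\<dots> = 1\<^sub>m m + B * (transpose_mat E * (V0 * N))"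
    using d N by simp
  also have "spectral_norm \<dots> \<le> 1 + (2 * sqrt a) * (\<eta> * (1 * spectral_norm N))"
  proof -
    have "spectral_norm B \<le> 2 * sqrt a"
      unfolding a_def by (rule spectral_norm_sqrt_factor_le[OF A dA V B eq \<eta>])
    then have "spectral_norm (B * (transpose_mat E * (V0 * N))) \<le> (2 * sqrt a) * (\<eta> * (1 * spectral_norm N))"
      using d V0 \<eta>0 spectral_norm_orthonormal_cols[OF V0(1)] t
      by (intro order_trans[OF spectral_norm_mult] mult_mono) auto
    then show ?thesis
      using d by (intro order_trans[OF spectral_norm_triangle] add_mono spectral_norm_one_le) auto
  qed
  finally have "spectral_norm N \<le> 2 * t * (1 + (2 * sqrt a) * (\<eta> * (1 * spectral_norm N)))"
    using t by (simp add: mult_left_mono)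
  then have 3: "spectral_norm N \<le> 2 * t + 4 * (t * sqrt a * \<eta>) * spectral_norm N"
    by (simp add: algebra_simps)
  \<comment> \<open>The quantity is the geometric mean of \<eta> and \<eta> a t^2, both at most
    1/16.\<close>
  have "(t * sqrt a * \<eta>)\<^sup>2 = \<eta> * (\<eta> * (a * t\<^sup>2))"
    using t by (simp add: power_mult_distrib) (simp add: power2_eq_square)
  also have "\<dots> \<le> (1/16) * (1/16)"
    using \<kappa> \<eta> \<eta>0 t by (intro mult_mono) (auto simp: a_def t_def)
  finally have "(t * sqrt a * \<eta>)\<^sup>2 \<le> (1/16)\<^sup>2" by (simp add: power2_eq_square)
  then have "t * sqrt a * \<eta> \<le> 1/16" by (rule power2_le_imp_le) simp
  then have "(t * sqrt a * \<eta>) * spectral_norm N \<le> (1/16) * spectral_norm N"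
    by (intro mult_right_mono) auto
  \<comment> \<open>A quarter of the norm of \<open>N\<close> moves to the left, and 2 / (3/4) =
    8/3.\<close>
  with 3 have "spectral_norm N \<le> (8/3) * t" by simp
  also have "\<dots> \<le> 3 * t" using t by simp
  finally show ?thesis by (simp add: t_def)
qed

section \<open>Error propagation through the algorithm\<close>

text \<open>With free bounds \<open>a\<close> and \<open>b\<close>, this rule and its two companions
  decompose a matrix expression in step with a bound bracketed in the same way.\<close>

lemma spectral_norm_mult_le:
  "spectral_norm M \<le> a \<Longrightarrow> spectral_norm N \<le> b \<Longrightarrow> dim_col M = dim_row N
    \<Longrightarrow> spectral_norm (M * N) \<le> a * b"
  by (intro order_trans[OF spectral_norm_mult] mult_mono)
    (auto intro: order_trans[OF spectral_norm_nonneg])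

lemma spectral_norm_add_le:
  "spectral_norm M \<le> a \<Longrightarrow> spectral_norm N \<le> b \<Longrightarrow> dim_row M = dim_row N
    \<Longrightarrow> dim_col M = dim_col N \<Longrightarrow> spectral_norm (M + N) \<le> a + b"
  by (intro order_trans[OF spectral_norm_triangle] add_mono) auto

lemma spectral_norm_minus_le:
  "spectral_norm M \<le> a \<Longrightarrow> spectral_norm N \<le> b \<Longrightarrow> dim_row M = dim_row N
    \<Longrightarrow> dim_col M = dim_col N \<Longrightarrow> spectral_norm (M - N) \<le> a + b"
  by (intro order_trans[OF spectral_norm_triangle_minus] add_mono) auto

text \<open>The models are solved backwards: W is bounded through R, X through W, and Z through X.
  Each time the error term is \<eta> times the unknown itself and is absorbed by the left
  side.\<close>

lemma oblique_qr_residual: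
  assumes V: "near_orthonormal m m \<eta> V" and \<eta>: "\<eta> \<le> 1/16"
    and B: "B \<in> carrier_mat m m" and N: "N \<in> carrier_mat m m" "N * B = 1\<^sub>m m" "spectral_norm N \<le> d"
    and Z: "Z \<in> carrier_mat m n" and R: "R \<in> carrier_mat n n"
    and Y: "Y \<in> carrier_mat m n" "spectral_norm Y \<le> 2"
    and dX: "dX \<in> carrier_mat m n" "X = transpose_mat V * Z + dX" "spectral_norm dX \<le> \<eta> * spectral_norm Z"
    and dS: "dS \<in> carrier_mat m n" "W = B * (X + dS)" "spectral_norm dS \<le> \<eta> * spectral_norm X"
    and dW: "dW \<in> carrier_mat m n" "W = Y * R + dW" "spectral_norm dW \<le> \<eta> * spectral_norm W"
    and dU: "dU \<in> carrier_mat m n" "U = N * (Y + dU)" "spectral_norm dU \<le> \<eta> * spectral_norm Y"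
    and dQ: "dQ \<in> carrier_mat m n" "Q = V * U + dQ" "spectral_norm dQ \<le> \<eta> * spectral_norm U"
  shows "spectral_norm (Z - Q * R) \<le> 112 * \<eta> * d * spectral_norm R"
proof -
  note \<eta>0 = near_orthonormal_nonneg[OF V]
  have d0: "0 \<le> d" using N(3) spectral_norm_nonneg[of N] by linarith
  have nV: "spectral_norm V \<le> 2" using spectral_norm_near_orthonormal[OF V] \<eta> by simp
  define r where "r = spectral_norm R"
  define w where "w = spectral_norm W"
  define x where "x = spectral_norm X"
  define z where "z = spectral_norm Z"
  have nn: "0 \<le> r" "0 \<le> w" "0 \<le> x" "0 \<le> z" by (auto simp: r_def w_def x_def z_def)
  have small: "\<eta> * y \<le> y / 16" if "0 \<le> y" for y using mult_right_mono[OF \<eta> that] by simp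
  have dims: "dim_row V = m" "dim_col V = m" "dim_row B = m" "dim_col B = m" "dim_row N = m" "dim_col N = m"
    "dim_row Z = m" "dim_col Z = n" "dim_row R = n" "dim_col R = n" "dim_row Y = m" "dim_col Y = n"
    "dim_row dX = m" "dim_col dX = n" "dim_row dS = m" "dim_col dS = n" "dim_row dW = m" "dim_col dW = n"
    "dim_row dU = m" "dim_col dU = n" "dim_row dQ = m" "dim_col dQ = n"
    using near_orthonormal_carrier[OF V] B N Z R Y dX dS dW dU dQ by auto
  have dims': "dim_row X = m" "dim_col X = n" "dim_row W = m" "dim_col W = n"
    "dim_row U = m" "dim_col U = n" "dim_row Q = m" "dim_col Q = n"
    using dims dX(2) dS(2) dU(2) dQ(2) by auto

  \<comment> \<open>An implicit bound: the error of the QR kernel is relative to W.\<close>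
  have "w \<le> 2 * r + \<eta> * w"
  proof -
    have "spectral_norm (Y * R + dW) \<le> 2 * r + \<eta> * w"
      unfolding w_def r_def using dims Y dW(3)
      by (intro spectral_norm_add_le spectral_norm_mult_le) auto
    then show ?thesis unfolding dW(2)[symmetric] w_def .
  qed
  then have w: "w \<le> 4 * r" using small[OF nn(2)] nn by linarith
  have NW: "N * W = X + dS"
  proof -
    have "N * W = (N * B) * (X + dS)" unfolding dS(2) using dims dims' by (simp add: mat_assoc_dim)
    then show ?thesis using N dims dims' by simp
  qed
  have "X = N * W - dS" unfolding NW using dims dims' by (intro eq_matI) auto
  moreover have "spectral_norm (N * W - dS) \<le> d * w + \<eta> * x"
    unfolding x_def w_def using dims dims' N dS(3)
    by (intro spectral_norm_minus_le spectral_norm_mult_le) auto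
  ultimately have "x \<le> d * w + \<eta> * x" by (simp add: x_def)
  then have "x \<le> 2 * (d * w)" using small[OF nn(3)] nn by linarith
  also have "d * w \<le> d * (4 * r)" using w d0 by (intro mult_left_mono)
  finally have x: "x \<le> 8 * (d * r)" by simp
  have VZ: "transpose_mat V * Z = X - dX" unfolding dX(2) using dims by (intro eq_matI) auto
  have "(1 - \<eta>) * z \<le> x + \<eta> * z"
  proof -
    have "(1 - \<eta>) * z \<le> spectral_norm (transpose_mat V * Z)"
      unfolding z_def using dims
      by (intro spectral_norm_le_near_orthonormal_mult[OF near_orthonormal_transpose[OF V]])
    also have "\<dots> \<le> x + \<eta> * z"
      unfolding VZ x_def z_def using dims dims' dX(3) by (intro spectral_norm_minus_le) auto
    finally show ?thesis .
  qed
  then have "z \<le> 2 * x" using small[OF nn(4)] nn by (simp add: algebra_simps)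
  with x have z: "z \<le> 16 * (d * r)" by linarith
  have "spectral_norm U \<le> d * (2 + \<eta> * 2)"
    unfolding dU(2) using dims N Y dU(3) \<eta>0
    by (intro spectral_norm_mult_le spectral_norm_add_le order_trans[OF dU(3)] mult_left_mono) auto
  also have "\<dots> \<le> d * 4" using d0 \<eta> by (intro mult_left_mono) auto
  finally have u: "spectral_norm U \<le> 4 * d" by simp

  have YR: "Y * R = W - dW" unfolding dW(2) using dims by (intro eq_matI) auto
  have "U * R = N * (Y * R) + N * (dU * R)" unfolding dU(2) using dims by (simp add: mat_ring_dim)
  \<comment> \<open>The scaling by \<open>B\<close> is undone exactly by \<open>N\<close>, so
    \<open>N\<close> remains only in front of \<open>dW\<close> and \<open>dU * R\<close>.\<close>
  also have "\<dots> = X + dS - N * dW + N * (dU * R)"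
    unfolding YR NW[symmetric] using dims dims' by (simp add: mat_ring_dim)
  finally have UR: "U * R = X + dS - N * dW + N * (dU * R)" .
  have "Q * R = V * (U * R) + dQ * R" unfolding dQ(2) using dims dims' by (simp add: mat_ring_dim)
  also have "\<dots> = V * (transpose_mat V * Z) + V * dX + V * dS - V * (N * dW) + V * (N * (dU * R)) + dQ * R"
    unfolding UR dX(2) using dims by (simp add: mat_ring_dim)
  finally have "Z - Q * R = - ((V * transpose_mat V - 1\<^sub>m m) * Z + V * dX + V * dS
      - V * (N * dW) + V * (N * (dU * R)) + dQ * R)"
    using dims Z by (intro eq_matI) (simp_all add: mat_ring_dim del: index_mult_mat(1))
  then have "spectral_norm (Z - Q * R) = spectral_norm ((V * transpose_mat V - 1\<^sub>m m) * Z + V * dX + V * dS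
      - V * (N * dW) + V * (N * (dU * R)) + dQ * R)" by simp
  also have "\<dots> \<le> (3 * \<eta>) * z + 2 * (\<eta> * z) + 2 * (\<eta> * x)
      + 2 * (d * (\<eta> * w)) + 2 * (d * ((\<eta> * 2) * r)) + (\<eta> * (4 * d)) * r"
  proof -
    have "spectral_norm (V * transpose_mat V - 1\<^sub>m m) \<le> 3 * \<eta>"
      using spectral_norm_near_orthonormal_gram[OF near_orthonormal_transpose[OF V]] \<eta> by simp
    moreover have "spectral_norm dU \<le> \<eta> * 2"
      using dU(3) mult_left_mono[OF Y(2) \<eta>0] by linarith
    moreover have "spectral_norm dQ \<le> \<eta> * (4 * d)"
      using dQ(3) mult_left_mono[OF u \<eta>0] by linarith
    ultimately show ?thesis
      using dims dims' nV N(3) dX(3) dS(3) dW(3) unfolding r_def w_def x_def z_def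
      by (intro spectral_norm_add_le spectral_norm_minus_le spectral_norm_mult_le) auto
  qed
  also have "\<dots> = \<eta> * (5 * z + 2 * x + 2 * (d * w) + 8 * (d * r))" by (simp add: algebra_simps)
  \<comment> \<open>With z \<le> 16 d r, x \<le> 8 d r and w \<le> 4 r the sum is 80 + 16 + 8 + 8 =
    112.\<close>
  also have "\<dots> \<le> \<eta> * (112 * (d * r))"
    using z x mult_left_mono[OF w d0] by (intro mult_left_mono \<eta>0) simp
  finally show ?thesis by (simp add: r_def mult_ac)
qed

text \<open>No norm of \<open>N\<close> and hence no condition number enters: \<open>B\<close>
  cancels \<open>N\<close> in \<open>B * U\<close>, and \<open>U\<close> is bounded through Q, not
  through its defining product.\<close>

lemma oblique_qr_orthogonality:
  assumes V: "near_orthonormal m m \<eta> V" and \<eta>: "\<eta> \<le> 1/16" and n: "0 < n"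
    and A: "A \<in> carrier_mat m m" and dA: "dA \<in> carrier_mat m m" "spectral_norm dA \<le> \<eta> * spectral_norm A"
    and eq: "A + dA = V * (B * B) * transpose_mat V"
    and B: "B \<in> carrier_mat m m" "transpose_mat B = B" and N: "N \<in> carrier_mat m m" "B * N = 1\<^sub>m m"
    and Y: "near_orthonormal m n \<eta> Y"
    and dU: "dU \<in> carrier_mat m n" "U = N * (Y + dU)" "spectral_norm dU \<le> \<eta> * spectral_norm Y"
    and dQ: "dQ \<in> carrier_mat m n" "Q = V * U + dQ" "spectral_norm dQ \<le> \<eta> * spectral_norm U"
  shows "spectral_norm (transpose_mat Q * A * Q - 1\<^sub>m n) \<le> 430 * \<eta> * spectral_norm A * (spectral_norm Q)\<^sup>2"
proof -
  note \<eta>0 = near_orthonormal_nonneg[OF V]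
  obtain Y0 EY where Y0: "orthonormal_cols m n Y0" "EY \<in> carrier_mat m n" "Y = Y0 + EY" "spectral_norm EY \<le> \<eta>"
    using Y by (auto simp: near_orthonormal_def)
  have nV: "spectral_norm V \<le> 2" using spectral_norm_near_orthonormal[OF V] \<eta> by simp
  have nY: "spectral_norm Y \<le> 2" using spectral_norm_near_orthonormal[OF Y] \<eta> by simp
  have ndU: "spectral_norm dU \<le> 2 * \<eta>" using dU(3) mult_left_mono[OF nY \<eta>0] by linarith
  define q where "q = spectral_norm Q"
  define b where "b = sqrt (spectral_norm A)"
  define s where "s = b * q"
  have nn: "0 \<le> q" "0 \<le> b" "0 \<le> s" by (auto simp: q_def b_def s_def)
  have nB: "spectral_norm B \<le> 2 * b"
    unfolding b_def by (rule spectral_norm_sqrt_factor_le[OF A dA V B eq \<eta>])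
  have dims: "dim_row V = m" "dim_col V = m" "dim_row B = m" "dim_col B = m" "dim_row N = m" "dim_col N = m"
    "dim_row A = m" "dim_col A = m" "dim_row dA = m" "dim_col dA = m" "dim_row Y0 = m" "dim_col Y0 = n"
    "dim_row EY = m" "dim_col EY = n" "dim_row dU = m" "dim_col dU = n" "dim_row dQ = m" "dim_col dQ = n"
    using near_orthonormal_carrier[OF V] B N A dA Y0 dU dQ by (auto simp: orthonormal_cols_def)
  have dims': "dim_row Y = m" "dim_col Y = n" "dim_row U = m" "dim_col U = n" "dim_row Q = m" "dim_col Q = n"
    using dims Y0(3) dU(2) dQ(2) by auto

  have VU: "V * U = Q - dQ" unfolding dQ(2) using dims dims' by (intro eq_matI) auto
  have "(1 - \<eta>) * spectral_norm U \<le> spectral_norm (V * U)"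
    using dims' by (intro spectral_norm_le_near_orthonormal_mult[OF V])
  also have "\<dots> \<le> q + \<eta> * spectral_norm U"
    unfolding VU q_def using dims dims' dQ(3) by (intro spectral_norm_minus_le) auto
  finally have "spectral_norm U * (1 - 2 * \<eta>) \<le> q" by (simp add: algebra_simps)
  moreover have "spectral_norm U * (1/2) \<le> spectral_norm U * (1 - 2 * \<eta>)"
    using \<eta> by (intro mult_left_mono) auto
  ultimately have nU: "spectral_norm U \<le> 2 * q" by linarith

  have BU: "B * U = Y0 + EY + dU"
  proof -
    have "B * U = (B * N) * (Y + dU)" unfolding dU(2) using dims dims' by (simp add: mat_assoc_dim)
    then show ?thesis using N dims dims' by (simp add: Y0(3))
  qed
  \<comment> \<open>This yields 1 \<le> 4 s + 3 \<eta> \<le> 4 s + 3/16, so s \<ge> 13/64 >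
    1/5.\<close>
  have "1 \<le> spectral_norm Y0" by (rule spectral_norm_orthonormal_cols_ge[OF Y0(1) n])
  also have "Y0 = B * U - EY - dU" unfolding BU using dims by (intro eq_matI) auto
  also have "spectral_norm \<dots> \<le> (2 * b) * (2 * q) + \<eta> + 2 * \<eta>"
    using dims dims' nB nU Y0(4) ndU by (intro spectral_norm_minus_le spectral_norm_mult_le) auto
  finally have s: "1 \<le> 5 * s" using \<eta> by (simp add: s_def)

  \<comment> \<open>\<open>F\<close> is V^T Q - U, the failure of V^T to undo V; \<open>H\<close> is
    then the deviation of B V^T Q from \<open>Y0\<close>.\<close>
  define F where "F = (transpose_mat V * V - 1\<^sub>m m) * U + transpose_mat V * dQ"
  define H where "H = EY + dU + B * F"
  have dimsH: "dim_row F = m" "dim_col F = n" "dim_row H = m" "dim_col H = n"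
    using dims dims' by (auto simp: F_def H_def)
  have "spectral_norm F \<le> (3 * \<eta>) * (2 * q) + 2 * (\<eta> * (2 * q))"
    unfolding F_def using dims dims' nU nV \<eta> \<eta>0 spectral_norm_near_orthonormal_gram[OF V]
    by (intro spectral_norm_add_le spectral_norm_mult_le order_trans[OF dQ(3)] mult_left_mono) auto
  then have "spectral_norm F \<le> 10 * \<eta> * q" by simp
  then have "spectral_norm H \<le> \<eta> + 2 * \<eta> + (2 * b) * (10 * \<eta> * q)"
    unfolding H_def using dims dimsH nB Y0(4) ndU
    by (intro spectral_norm_add_le spectral_norm_mult_le) auto
  also have "\<dots> = \<eta> * (3 + 20 * s)" by (simp add: s_def algebra_simps)
  \<comment> \<open>The constant 3 is at most 15 s, by the lower bound on s.\<close>
  also have "\<dots> \<le> \<eta> * (35 * s)" using s \<eta>0 by (intro mult_left_mono) auto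
  finally have nH: "spectral_norm H \<le> 35 * \<eta> * s" by simp

  define G where "G = B * (transpose_mat V * Q)"
  have G: "G = Y0 + H"
  proof -
    have "transpose_mat V * Q = U + F"
      unfolding F_def dQ(2) using dims dims'
      by (intro eq_matI) (simp_all add: mat_ring_dim del: index_mult_mat(1))
    then have "G = B * U + B * F" unfolding G_def using dims dims' dimsH by (simp add: mat_ring_dim)
    then show ?thesis unfolding BU H_def using dims dimsH
      by (intro eq_matI) (simp_all del: index_mult_mat(1))
  qed
  have "transpose_mat G * G = transpose_mat Q * (A + dA) * Q"
    unfolding G_def eq using dims dims' B by (simp add: mat_ring_dim)
  then have "transpose_mat Q * A * Q - 1\<^sub>m n = (transpose_mat G * G - 1\<^sub>m n) - transpose_mat Q * (dA * Q)"
    using dims dims' by (intro eq_matI) (simp_all add: mat_ring_dim del: index_mult_mat(1))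
  also have "spectral_norm \<dots> \<le> (2 * spectral_norm H + (spectral_norm H)\<^sup>2) + q * ((\<eta> * b\<^sup>2) * q)"
  proof (rule spectral_norm_minus_le)
    show "spectral_norm (transpose_mat G * G - 1\<^sub>m n) \<le> 2 * spectral_norm H + (spectral_norm H)\<^sup>2"
      unfolding G using dimsH by (intro spectral_norm_gram_perturbed[OF Y0(1)]) auto
    show "spectral_norm (transpose_mat Q * (dA * Q)) \<le> q * ((\<eta> * b\<^sup>2) * q)"
      unfolding q_def b_def using dims dims' dA by (intro spectral_norm_mult_le) auto
  qed (use dims dims' in \<open>auto simp: G_def\<close>)
  also have "\<dots> \<le> (2 * (35 * \<eta> * s) + (35 * \<eta> * s)\<^sup>2) + q * ((\<eta> * b\<^sup>2) * q)"
    using nH by (intro add_right_mono add_mono mult_left_mono power_mono) auto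
  also have "\<dots> = \<eta> * (70 * s + 1225 * (\<eta> * s\<^sup>2) + s\<^sup>2)"
    by (simp add: s_def power2_eq_square algebra_simps)
  \<comment> \<open>The coefficients are 70 * 5 = 350, 1225/16 < 77 and 1, with sum below
    430.\<close>
  also have "\<dots> \<le> \<eta> * (430 * s\<^sup>2)"
  proof (intro mult_left_mono \<eta>0)
    have "s * 1 \<le> s * (5 * s)" using s nn by (intro mult_left_mono) auto
    then have 1: "s \<le> 5 * s\<^sup>2" by (simp add: power2_eq_square)
    have 2: "\<eta> * s\<^sup>2 \<le> (1/16) * s\<^sup>2" using \<eta> by (intro mult_right_mono) auto
    show "70 * s + 1225 * (\<eta> * s\<^sup>2) + s\<^sup>2 \<le> 430 * s\<^sup>2" using 1 2 zero_le_power2[of s] by linarith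
  qed
  also have "\<dots> = 430 * \<eta> * spectral_norm A * (spectral_norm Q)\<^sup>2"
    by (simp add: s_def q_def b_def power_mult_distrib)
  finally show ?thesis .
qed

text \<open>The constants precede all dimensions and depend only on \<open>K\<close>. The residual
  bound assumes a small condition number times m^(5/2) u, so that D^(-1/2) is controlled by
  A^(-1/2). The second bound assumes accuracy of order m^(5/2) u for \<open>Y\<close>, because the
  QR model gives only m n^2 u, which is m^3 u for n = m.\<close>

theorem theorem5p1:
  fixes K :: real
  assumes "K > 0"
  shows "\<exists>c > 0. \<exists>C \<ge> 0. \<exists>\<epsilon> > 0.
    \<forall>(m::nat) (n::nat) (u::real) A Ainvsqrt Z V D X W Y R U Q.
      0 < n \<longrightarrow> n \<le> m \<longrightarrow>
      sym_pos_def m A \<longrightarrow> is_inv_sqrt m A Ainvsqrt \<longrightarrow>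
      Z \<in> carrier_mat m n \<longrightarrow> vec_space.rank m Z = n \<longrightarrow>
      0 < u \<longrightarrow> real m powr (5/2) * u \<le> \<epsilon> \<longrightarrow> real m * (real n)\<^sup>2 * u \<le> \<epsilon> \<longrightarrow>
      evd_oblique_qr_computed K u m n A Z V D X W Y R U Q \<longrightarrow>
      (real m powr (5/2) * u * (spectral_norm A * (spectral_norm Ainvsqrt)\<^sup>2) \<le> \<epsilon> \<longrightarrow>
         spectral_norm (Z - Q * R)
           \<le> c * real m powr (5/2) * u * spectral_norm Ainvsqrt * spectral_norm R) \<and>
      (near_orthonormal m n (K * real m powr (5/2) * u) Y \<longrightarrow>
         spectral_norm (transpose_mat Q * A * Q - 1\<^sub>m n)
           \<le> c * real m powr (5/2) * u * spectral_norm A * (spectral_norm Q)\<^sup>2 + C * u\<^sup>2)"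
proof (intro exI conjI allI impI)
  \<comment> \<open>The choice of \<epsilon> makes \<eta> at most 1/16. The factor 430 also covers
    the residual constant 336, and the second-order constant is 0.\<close>
  show "0 < 430 * K" "(0::real) \<le> 0" "0 < 1 / (16 * K)" using assms by auto
next
  fix m n :: nat and u :: real and A T Z V D X W Y R U Q
  assume n: "0 < n" "n \<le> m" and A: "sym_pos_def m A" and T: "is_inv_sqrt m A T"
    and Z: "Z \<in> carrier_mat m n" and u: "0 < u"
    and small: "real m powr (5/2) * u \<le> 1 / (16 * K)" "real m * (real n)\<^sup>2 * u \<le> 1 / (16 * K)"
    and comp: "evd_oblique_qr_computed K u m n A Z V D X W Y R U Q"
  define \<eta> where "\<eta> = K * real m powr (5/2) * u"
  have \<eta>0: "0 \<le> \<eta>" using assms u by (simp add: \<eta>_def)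
  have \<eta>: "\<eta> \<le> 1/16" "K * real m * (real n)\<^sup>2 * u \<le> 1/16"
    using small assms by (simp_all add: \<eta>_def field_simps)
  have m1: "1 \<le> real m" using n by simp
  have "real m powr 1 \<le> real m powr (5/2)" using m1 by (intro powr_mono) auto
  then have m2: "real m \<le> real m powr (5/2)" using m1 by simp
  \<comment> \<open>Here \<open>n \<le> m\<close> brings the QR backward error down to the common
    order m^(5/2).\<close>
  have "real m * real n powr (3/2) \<le> real m powr 1 * real m powr (3/2)"
    using n by (intro mult_mono powr_mono2) auto
  also have "\<dots> = real m powr (5/2)" by (simp only: powr_add[symmetric]) simp
  finally have m3: "real m * real n powr (3/2) \<le> real m powr (5/2)" .
  \<comment> \<open>All kernel errors are weakened to the single level \<eta>, so that the
    dimensions disappear from the estimates.\<close>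
  have weak: "x \<le> \<eta> * y" if "x \<le> K * k * u * y" "k \<le> real m powr (5/2)" "0 \<le> y" for x y k
  proof -
    have "K * k * u * y \<le> K * real m powr (5/2) * u * y"
      using that assms u by (intro mult_right_mono mult_left_mono) auto
    then show ?thesis using that by (simp add: \<eta>_def)
  qed
  have Ac: "A \<in> carrier_mat m m" using A by (simp add: sym_pos_def_def)
  from comp have evd: "evd_model K u m A V D" and vtz: "vtz_model K u m n V Z X"
    and sc: "scale_model K u m n D X W" and qr: "qr_model K u m n W Y R"
    and us: "unscale_model K u m n D Y U" and vu: "vu_model K u m n V U Q"
    by (auto simp: evd_oblique_qr_computed_def)
  from evd obtain dA where D: "D \<in> carrier_mat m m" "diagonal_mat D" "\<forall>i<m. D $$ (i, i) > 0"
    and dA: "dA \<in> carrier_mat m m" "spectral_norm dA \<le> \<eta> * spectral_norm A"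
    and eq: "A + dA = V * D * transpose_mat V" and V: "near_orthonormal m m \<eta> V"
    by (auto simp: evd_model_def \<eta>_def)
  let ?B = "diag_sqrt D" and ?N = "diag_inv_sqrt D"
  note BN = diag_sqrt_props[OF D]
  have eq': "A + dA = V * (?B * ?B) * transpose_mat V" using eq BN by simp
  from vtz obtain dX where dX: "dX \<in> carrier_mat m n" "X = transpose_mat V * Z + dX"
      "spectral_norm dX \<le> \<eta> * spectral_norm Z"
    using weak[OF _ m2] by (auto simp: vtz_model_def)
  from sc obtain dS where dS: "dS \<in> carrier_mat m n" "W = ?B * (X + dS)"
      "spectral_norm dS \<le> \<eta> * spectral_norm X"
    using weak[of _ 1] m1 m2 by (auto simp: scale_model_def)
  from qr obtain dW where R: "R \<in> carrier_mat n n"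
    and Y: "near_orthonormal m n (K * real m * (real n)\<^sup>2 * u) Y"
    and dW: "dW \<in> carrier_mat m n" "W = Y * R + dW" "spectral_norm dW \<le> \<eta> * spectral_norm W"
    using weak[OF _ m3] by (auto simp: qr_model_def mult.assoc)
  from us obtain dU where dU: "dU \<in> carrier_mat m n" "U = ?N * (Y + dU)"
      "spectral_norm dU \<le> \<eta> * spectral_norm Y"
    using weak[of _ 1] m1 m2 by (auto simp: unscale_model_def)
  from vu obtain dQ where dQ: "dQ \<in> carrier_mat m n" "Q = V * U + dQ"
      "spectral_norm dQ \<le> \<eta> * spectral_norm U"
    using weak[OF _ m2] by (auto simp: vu_model_def)
  \<comment> \<open>The residual needs only the size of \<open>Y\<close>, for which the accuracy m
    n^2 u of the QR model is enough.\<close>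
  have nY: "spectral_norm Y \<le> 2" using spectral_norm_near_orthonormal[OF Y] \<eta> by simp
  {
    assume "real m powr (5/2) * u * (spectral_norm A * (spectral_norm T)\<^sup>2) \<le> 1 / (16 * K)"
    then have \<kappa>: "\<eta> * (spectral_norm A * (spectral_norm T)\<^sup>2) \<le> 1/16"
      using assms by (simp add: \<eta>_def field_simps)
    have "spectral_norm ?N \<le> 3 * spectral_norm T"
      by (rule spectral_norm_inverse_sqrt_factor_le[OF Ac dA V BN(1,3,2,5) eq' \<eta>(1) T \<kappa>])
    then have "spectral_norm (Z - Q * R) \<le> 112 * \<eta> * (3 * spectral_norm T) * spectral_norm R"
      by (rule oblique_qr_residual[OF V \<eta>(1) BN(1,2,6) _ Z R near_orthonormal_carrier[OF Y] nY dX dS dW dU dQ])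
    also have "\<dots> = 336 * (\<eta> * spectral_norm T * spectral_norm R)" by simp
    also have "\<dots> \<le> 430 * (\<eta> * spectral_norm T * spectral_norm R)"
      using \<eta>0 by (intro mult_right_mono) auto
    finally show "spectral_norm (Z - Q * R)
        \<le> 430 * K * real m powr (5/2) * u * spectral_norm T * spectral_norm R"
      by (simp add: \<eta>_def mult.assoc)
  }
  {
    assume "near_orthonormal m n (K * real m powr (5/2) * u) Y"
    then have Y': "near_orthonormal m n \<eta> Y" by (simp add: \<eta>_def)
    have "spectral_norm (transpose_mat Q * A * Q - 1\<^sub>m n) \<le> 430 * \<eta> * spectral_norm A * (spectral_norm Q)\<^sup>2"
      by (rule oblique_qr_orthogonality[OF V \<eta>(1) n(1) Ac dA eq' BN(1,3,2,5) Y' dU dQ])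
    then show "spectral_norm (transpose_mat Q * A * Q - 1\<^sub>m n)
        \<le> 430 * K * real m powr (5/2) * u * spectral_norm A * (spectral_norm Q)\<^sup>2 + 0 * u\<^sup>2"
      by (simp add: \<eta>_def mult.assoc)
  }
qed

end
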